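(* Let $R$ be a commutative Noetherian ring with identity, $M$ a finitely generated unitary $R$-module, $N$ a proper submodule of $M$, and $\mathfrak{a}=\mathrm{Ann}(M/N)$. Then $\mathcal{P}_M(N)$ is a multiple of $\mathcal{P}_R(\mathfrak{a})$ as a product of prime ideals; that is, every prime ideal occurs in the formal product $\mathcal{P}_M(N)$ at least as many times as it occurs in $\mathcal{P}_R(\mathfrak{a})$.
   Context: Throughout, $R$ is a commutative Noetherian ring with identity and $M$ is a finitely generated unitary $R$-module; ideals of $R$ are regarded as submodules of the $R$-module $R$. The symbol $\subset$ denotes proper inclusion. For submodules $N,K$ of $M$, $(N:K)=\{a\in R \mid aK\subseteq N\}$; for an ideal $I$ of $R$, $(N:I)=\{x\in M\mid Ix\subseteq N\}$. $\mathrm{Ass}(M/N)$ is the set of associated primes of $M/N$, and $\mathrm{Ann}(M/N)=(N:M)$. Prime submodule: a proper submodule $N$ of $M$ is a $\mathfrak{p}$-prime submodule of $M$ if $(N:M)=\mathfrak{p}$ and for all $a\in R$, $x\in M$, $ax\in N$ implies $a\in (N:M)$ or $x\in N$ (then $\mathfrak p$ is a prime ideal). A submodule $K\supset N$ of $M$ is a $\mathfrak{p}$-prime extension of $N$, written $N\overset{\mathfrak p}{\subset}K$, if $N$ is a $\mathfrak{p}$-prime submodule of $K$. If $\mathfrak{p}$ is a maximal element (under inclusion) of $\mathrm{Ass}(M/N)$, then $(N:\mathfrak{p})$ is the unique maximal $\mathfrak{p}$-prime extension of $N$ in $M$, and it is called the regular $\mathfrak{p}$-prime extension of $N$ in $M$.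 RPE filtration: a filtration $N=M_0\overset{\mathfrak{p}_1}{\subset}M_1\subset\cdots\overset{\mathfrak{p}_n}{\subset}M_n=M$ is a regular prime extension (RPE) filtration of $M$ over $N$ if each $M_i$ is a regular $\mathfrak{p}_i$-prime extension of $M_{i-1}$ in $M$, $1\le i\le n$. Factorization: for a proper submodule $N$ of $M$, RPE filtrations of $M$ over $N$ exist, and it is known that the number of occurrences of each prime ideal is the same in all of them. The generalized prime ideal factorization of $N$ in $M$ is the formal product $\mathcal{P}_M(N)=\mathfrak{p}_1\cdots\mathfrak{p}_n$ of the primes occurring in any RPE filtration of $M$ over $N$, i.e. the multiset of these primes. $\mathcal{P}_R(\mathfrak{a})$ is the factorization of the proper ideal $\mathfrak{a}$ regarded as a submodule of the $R$-module $R$. *)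

theory Defs
  imports "HOL-Algebra.Algebra" "HOL-Library.Multiset"
begin

text \<open>
  Modules are those of HOL-Algebra: a record \<open>M\<close> with \<open>module R M\<close>. A submodule is a set
  \<open>N\<close> with \<open>submodule N R M\<close>; where it has to be a module itself, it is the record
  \<open>M\<lparr>carrier := N\<rparr>\<close>.
\<close>

definition finitely_generated_module ::
    "('a, 'r) ring_scheme \<Rightarrow> ('a, 'm, 'd) module_scheme \<Rightarrow> bool" where
  "finitely_generated_module R M \<longleftrightarrow>
     (\<exists>A \<subseteq> carrier M. finite A \<and> carrier M = \<Inter> {H. submodule H R M \<and> A \<subseteq> H})"

definition module_of_ring :: "('a, 'r) ring_scheme \<Rightarrow> ('a, 'a) module" where
  "module_of_ring R =
     \<lparr>carrier = carrier R, monoid.mult = monoid.mult R, one = one R, ring.zero = ring.zero R, add = add R,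
      smult = monoid.mult R\<rparr>"

text \<open>
  The fields \<open>mult\<close> and \<open>one\<close> of a module record carry no meaning for \<^const>\<open>module\<close>.
\<close>

definition quotient_module ::
    "('a, 'm, 'd) module_scheme \<Rightarrow> 'm set \<Rightarrow> ('a, 'm set) module" where
  "quotient_module M N =
     \<lparr>carrier = a_rcosets\<^bsub>M\<^esub> N, monoid.mult = undefined, one = undefined, ring.zero = N, add = set_add M,
      smult = (\<lambda>a C. \<Union>x\<in>C. N +>\<^bsub>M\<^esub> (a \<odot>\<^bsub>M\<^esub> x))\<rparr>"

definition annihilator ::
    "('a, 'r) ring_scheme \<Rightarrow> ('a, 'm, 'd) module_scheme \<Rightarrow> 'a set" where
  "annihilator R M = {a \<in> carrier R. \<forall>x \<in> carrier M. a \<odot>\<^bsub>M\<^esub> x = \<zero>\<^bsub>M\<^esub>}"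

definition associated_primes ::
    "('a, 'r) ring_scheme \<Rightarrow> ('a, 'm, 'd) module_scheme \<Rightarrow> 'a set set" where
  "associated_primes R M =
     {P. primeideal P R \<and>
         (\<exists>x \<in> carrier M. P = {a \<in> carrier R. a \<odot>\<^bsub>M\<^esub> x = \<zero>\<^bsub>M\<^esub>})}"

text \<open>The two colons \<open>(N : K)\<close> in \<open>R\<close> and \<open>(N : I)\<close> in \<open>M\<close>.\<close>

definition colon_in_ring ::
    "('a, 'r) ring_scheme \<Rightarrow> ('a, 'm, 'd) module_scheme \<Rightarrow> 'm set \<Rightarrow> 'm set \<Rightarrow> 'a set" where
  "colon_in_ring R M N K = {a \<in> carrier R. \<forall>x \<in> K. a \<odot>\<^bsub>M\<^esub> x \<in> N}"

definition colon_in_module ::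
    "('a, 'm, 'd) module_scheme \<Rightarrow> 'm set \<Rightarrow> 'a set \<Rightarrow> 'm set" where
  "colon_in_module M N I = {x \<in> carrier M. \<forall>a \<in> I. a \<odot>\<^bsub>M\<^esub> x \<in> N}"

definition prime_submodule ::
    "('a, 'r) ring_scheme \<Rightarrow> ('a, 'm, 'd) module_scheme \<Rightarrow> 'a set \<Rightarrow> 'm set \<Rightarrow> bool" where
  "prime_submodule R M P N \<longleftrightarrow>
     submodule N R M \<and> N \<noteq> carrier M \<and> colon_in_ring R M N (carrier M) = P \<and>
     (\<forall>a \<in> carrier R. \<forall>x \<in> carrier M.
        a \<odot>\<^bsub>M\<^esub> x \<in> N \<longrightarrow> a \<in> colon_in_ring R M N (carrier M) \<or> x \<in> N)"

definition prime_extension ::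
    "('a, 'r) ring_scheme \<Rightarrow> ('a, 'm, 'd) module_scheme \<Rightarrow> 'a set \<Rightarrow> 'm set \<Rightarrow> 'm set \<Rightarrow> bool"
  where
  "prime_extension R M P N K \<longleftrightarrow>
     submodule K R M \<and> N \<subset> K \<and> prime_submodule R (M\<lparr>carrier := K\<rparr>) P N"

definition regular_prime_extension ::
    "('a, 'r) ring_scheme \<Rightarrow> ('a, 'm, 'd) module_scheme \<Rightarrow> 'a set \<Rightarrow> 'm set \<Rightarrow> 'm set \<Rightarrow> bool"
  where
  "regular_prime_extension R M P N K \<longleftrightarrow>
     P \<in> associated_primes R (quotient_module M N) \<and>
     (\<forall>Q \<in> associated_primes R (quotient_module M N). P \<subseteq> Q \<longrightarrow> Q = P) \<and>
     prime_extension R M P N K \<and>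
     K = colon_in_module M N P"

text \<open>
  \<open>Ms\<close> is the list \<open>[M\<^sub>0, \<dots>, M\<^sub>n]\<close> and \<open>Ps\<close> is the list \<open>[P\<^sub>1, \<dots>, P\<^sub>n]\<close>, so that \<open>Ps ! i\<close>
  belongs to the step from \<open>Ms ! i\<close> to \<open>Ms ! Suc i\<close>.
\<close>

definition RPE_filtration ::
    "('a, 'r) ring_scheme \<Rightarrow> ('a, 'm, 'd) module_scheme \<Rightarrow> 'm set \<Rightarrow>
     'm set list \<Rightarrow> 'a set list \<Rightarrow> bool" where
  "RPE_filtration R M N Ms Ps \<longleftrightarrow>
     length Ms = Suc (length Ps) \<and> hd Ms = N \<and> last Ms = carrier M \<and>
     (\<forall>i < length Ps. regular_prime_extension R M (Ps ! i) (Ms ! i) (Ms ! Suc i))"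

text \<open>
  The formal product of the primes occurring in any RPE filtration of \<open>M\<close> over \<open>N\<close>. The
  description is meaningful because, for a proper submodule \<open>N\<close> of a finitely generated module
  over a Noetherian ring, an RPE filtration exists and the multiset of its primes does not
  depend on the choice of the filtration.
\<close>

definition prime_ideal_factorization ::
    "('a, 'r) ring_scheme \<Rightarrow> ('a, 'm, 'd) module_scheme \<Rightarrow> 'm set \<Rightarrow> 'a set multiset" where
  "prime_ideal_factorization R M N =
     (THE F. \<exists>Ms Ps. RPE_filtration R M N Ms Ps \<and> F = mset Ps)"

end

theory Submission
  imports Defs
begin

text \<open>
  Fix a prime \<open>P\<close>. The number of occurrences of \<open>P\<close> in a regular prime extension filtration over
  \<open>N\<close> can be read off from the localization at \<open>P\<close>: it is the least \<open>k\<close> at which the chain of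
  colons \<open>(N : P\<^sup>k)\<close>, formed in \<open>M\<^sub>P\<close>, becomes stationary. In \<open>M\<close> itself, this is the chain \<open>L\<^sub>0\<close>,
  \<open>L\<^sub>1\<close>, ... where \<open>L\<^sub>0\<close> is the contraction of \<open>N\<^sub>P\<close> to \<open>M\<close> and each \<open>L\<^sub>k\<^sub>+\<^sub>1\<close> is \<open>(L\<^sub>k : P)\<close>; it is
  called \<open>local_colon_chain\<close> below.

  To see this, let \<open>K = (N : Q)\<close> be the first term of the filtration after \<open>N\<close>, and compare the
  chains of \<open>N\<close> and \<open>K\<close>. If \<open>Q = P\<close>, the chain of \<open>K\<close> is that of \<open>N\<close> without \<open>L\<^sub>0\<close>, and \<open>L\<^sub>0 \<noteq> L\<^sub>1\<close>
  because \<open>P\<close> is associated. If \<open>Q\<close> is not contained in \<open>P\<close>, then \<open>N\<close> and \<open>K\<close> have the same localization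
  at \<open>P\<close>. If \<open>Q\<close> is properly contained in \<open>P\<close>, then the maximality of \<open>Q\<close> says that \<open>P\<close> is not
  associated to \<open>M / N\<close>, so the chain of \<open>N\<close> is constant, and so is the chain of \<open>K\<close>, because colons
  commute with each other and with localization. Induction on the filtration gives
  \<open>count_RPE_filtration_le_iff\<close>, and in particular the multiset of primes depends on \<open>N\<close> alone.

  Now let \<open>\<aa> = (N : M)\<close>. Colons commute, and since \<open>M\<close> is finitely generated, \<open>(N : M)\<close> also
  commutes with localization; so the chain of \<open>\<aa>\<close> in \<open>R\<close> consists of the ideals \<open>(L\<^sub>k : M)\<close>
  (\<open>local_colon_chain_annihilator\<close>). Hence it becomes stationary no later than the chain of \<open>N\<close>,
  which is the inequality of multiplicities.

  Existence of the filtrations (\<open>ex_RPE_filtration\<close>) is needed for the factorizations to be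
  determined by their description. A regular prime extension of a proper submodule comes from a
  maximal element among the colons \<open>(N : x)\<close> with \<open>x \<notin> N\<close>, and the ascending chain condition on
  submodules ends the process.
\<close>

section \<open>Submodules, colons and quotient modules\<close>

locale module_over_noetherian_ring = module R M + noetherian_ring R
  for R (structure) and M (structure)

locale finitely_generated_module_over_noetherian_ring = module_over_noetherian_ring +
  assumes finitely_generated: "finitely_generated_module R M"

context module
begin

lemma smult_left_commute:
  assumes "a \<in> carrier R" "b \<in> carrier R" "x \<in> carrier M"
  shows "a \<odot>\<^bsub>M\<^esub> (b \<odot>\<^bsub>M\<^esub> x) = b \<odot>\<^bsub>M\<^esub> (a \<odot>\<^bsub>M\<^esub> x)"
  using assms by (metis m_comm smult_assoc1)

lemma submodule_subset: "submodule N R M \<Longrightarrow> x \<in> N \<Longrightarrow> x \<in> carrier M"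
  using submoduleE(1) by blast

lemma submodule_smult: "submodule N R M \<Longrightarrow> a \<in> carrier R \<Longrightarrow> x \<in> N \<Longrightarrow> a \<odot>\<^bsub>M\<^esub> x \<in> N"
  using submoduleE(4) by blast

lemma submodule_add: "submodule N R M \<Longrightarrow> x \<in> N \<Longrightarrow> y \<in> N \<Longrightarrow> x \<oplus>\<^bsub>M\<^esub> y \<in> N"
  using submoduleE(5) by blast

lemma submodule_neg: "submodule N R M \<Longrightarrow> x \<in> N \<Longrightarrow> \<ominus>\<^bsub>M\<^esub> x \<in> N"
  using submoduleE(3) by blast

lemma submodule_zero: "submodule N R M \<Longrightarrow> \<zero>\<^bsub>M\<^esub> \<in> N"
  by (metis submoduleE(2) submodule_smult submodule_subset ex_in_conv smult_l_null R.zero_closed)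

lemma submodule_abelian_subgroup:
  assumes "submodule N R M"
  shows "abelian_subgroup N M"
  using assms M.abelian_group_axioms
  by (intro abelian_subgroupI3 additive_subgroup.intro submodule.axioms(1))

lemma ideal_colon_element:
  assumes N: "submodule N R M" and x: "x \<in> carrier M"
  shows "ideal {a \<in> carrier R. a \<odot>\<^bsub>M\<^esub> x \<in> N} R"
proof (rule idealI)
  show "subgroup {a \<in> carrier R. a \<odot>\<^bsub>M\<^esub> x \<in> N} (add_monoid R)"
  proof (rule R.add.subgroupI)
    show "{a \<in> carrier R. a \<odot>\<^bsub>M\<^esub> x \<in> N} \<noteq> {}"
      using submodule_zero[OF N] x by (auto intro!: exI[of _ \<zero>])
  qed (use N x in \<open>auto simp: smult_l_minus smult_l_distr submodule_neg submodule_add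
         simp flip: a_inv_def\<close>)
next
  fix a b assume a: "a \<in> {a \<in> carrier R. a \<odot>\<^bsub>M\<^esub> x \<in> N}" and b: "b \<in> carrier R"
  thus ba: "b \<otimes> a \<in> {a \<in> carrier R. a \<odot>\<^bsub>M\<^esub> x \<in> N}"
    using N x by (simp add: smult_assoc1 submodule_smult)
  thus "a \<otimes> b \<in> {a \<in> carrier R. a \<odot>\<^bsub>M\<^esub> x \<in> N}"
    using a b by (simp add: m_comm)
qed (rule R.ring_axioms)

lemma submodule_colon_in_module:
  assumes N: "submodule N R M" and I: "I \<subseteq> carrier R"
  shows "submodule (colon_in_module M N I) R M"
proof (rule submoduleI)
  fix a x assume "a \<in> carrier R" "x \<in> colon_in_module M N I"
  thus "a \<odot>\<^bsub>M\<^esub> x \<in> colon_in_module M N I"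
    using assms smult_left_commute[of _ a x]
    by (auto simp: colon_in_module_def submodule_smult subset_iff)
qed (use assms in \<open>auto simp: colon_in_module_def smult_r_minus smult_r_distr submodule_zero
       submodule_neg submodule_add subset_iff\<close>)

lemma subset_colon_in_module:
  assumes "submodule N R M" "I \<subseteq> carrier R"
  shows "N \<subseteq> colon_in_module M N I"
  using assms by (auto simp: colon_in_module_def submodule_subset submodule_smult subset_iff)

lemma colon_in_module_commute:
  assumes "I \<subseteq> carrier R" "J \<subseteq> carrier R"
  shows "colon_in_module M (colon_in_module M L I) J = colon_in_module M (colon_in_module M L J) I"
proof -
  have "a \<odot>\<^bsub>M\<^esub> (b \<odot>\<^bsub>M\<^esub> x) = b \<odot>\<^bsub>M\<^esub> (a \<odot>\<^bsub>M\<^esub> x)"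
    if "a \<in> I" "b \<in> J" "x \<in> carrier M" for a b x
    using that assms by (intro smult_left_commute) auto
  with assms show ?thesis
    by (auto simp: colon_in_module_def subset_iff)
qed

text \<open>
  The scalar multiplication of the quotient is a union over all representatives of the coset; the
  point is that every representative contributes the same coset.
\<close>

lemma smult_quotient_module:
  assumes N: "submodule N R M" and a: "a \<in> carrier R" and x: "x \<in> carrier M"
  shows "a \<odot>\<^bsub>quotient_module M N\<^esub> (N +>\<^bsub>M\<^esub> x) = N +>\<^bsub>M\<^esub> (a \<odot>\<^bsub>M\<^esub> x)"
proof -
  interpret N: abelian_subgroup N M by (rule submodule_abelian_subgroup[OF N])
  have "N +>\<^bsub>M\<^esub> (a \<odot>\<^bsub>M\<^esub> y) = N +>\<^bsub>M\<^esub> (a \<odot>\<^bsub>M\<^esub> x)" if "y \<in> N +>\<^bsub>M\<^esub> x" for y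
  proof -
    from that obtain n where n: "n \<in> N" "y = n \<oplus>\<^bsub>M\<^esub> x"
      by (auto simp: a_r_coset_def')
    have "a \<odot>\<^bsub>M\<^esub> y = a \<odot>\<^bsub>M\<^esub> n \<oplus>\<^bsub>M\<^esub> a \<odot>\<^bsub>M\<^esub> x"
      using n a x N by (simp add: smult_r_distr submodule_subset)
    hence "a \<odot>\<^bsub>M\<^esub> y \<in> N +>\<^bsub>M\<^esub> (a \<odot>\<^bsub>M\<^esub> x)"
      using n a N by (auto simp: a_r_coset_def' submodule_smult)
    thus ?thesis
      using N.a_repr_independence'[of "a \<odot>\<^bsub>M\<^esub> y" "a \<odot>\<^bsub>M\<^esub> x"] a x by simp
  qed
  moreover have "x \<in> N +>\<^bsub>M\<^esub> x"
    using x by (rule N.a_rcos_self)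
  ultimately have "(\<Union>y \<in> N +>\<^bsub>M\<^esub> x. N +>\<^bsub>M\<^esub> (a \<odot>\<^bsub>M\<^esub> y)) = N +>\<^bsub>M\<^esub> (a \<odot>\<^bsub>M\<^esub> x)"
    by blast
  thus ?thesis
    by (simp add: quotient_module_def)
qed

lemma smult_quotient_module_eq_zero_iff:
  assumes N: "submodule N R M" and a: "a \<in> carrier R" and x: "x \<in> carrier M"
  shows "a \<odot>\<^bsub>quotient_module M N\<^esub> (N +>\<^bsub>M\<^esub> x) = \<zero>\<^bsub>quotient_module M N\<^esub> \<longleftrightarrow> a \<odot>\<^bsub>M\<^esub> x \<in> N"
proof -
  interpret N: abelian_subgroup N M by (rule submodule_abelian_subgroup[OF N])
  have "N +>\<^bsub>M\<^esub> y = N \<longleftrightarrow> y \<in> N" if "y \<in> carrier M" for y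
    using N.a_rcos_self[OF that] N.a_rcos_const[of y] by auto
  thus ?thesis
    using assms by (simp add: smult_quotient_module) (simp add: quotient_module_def)
qed

lemma carrier_quotient_module:
  "carrier (quotient_module M N) = (\<lambda>x. N +>\<^bsub>M\<^esub> x) ` carrier M"
  by (auto simp: quotient_module_def a_r_coset_def A_RCOSETS_def RCOSETS_def)

lemma associated_primes_quotient_iff:
  assumes N: "submodule N R M"
  shows "P \<in> associated_primes R (quotient_module M N) \<longleftrightarrow>
           primeideal P R \<and> (\<exists>x \<in> carrier M. P = {a \<in> carrier R. a \<odot>\<^bsub>M\<^esub> x \<in> N})"
  using smult_quotient_module_eq_zero_iff[OF N]
  by (simp add: associated_primes_def carrier_quotient_module cong: conj_cong)

lemma annihilator_quotient_module:
  assumes "submodule N R M"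
  shows "annihilator R (quotient_module M N) = colon_in_ring R M N (carrier M)"
  using smult_quotient_module_eq_zero_iff[OF assms]
  by (auto simp: annihilator_def colon_in_ring_def carrier_quotient_module)

end

section \<open>Colon chains in the localization at a prime\<close>

text \<open>
  The preimage in \<open>M\<close> of the submodule \<open>N\<^sub>P\<close> of \<open>M\<^sub>P\<close>. Working with it avoids fractions, and
  loses nothing because a submodule of \<open>M\<^sub>P\<close> is determined by its preimage.
\<close>

definition localization_contraction ::
    "('a, 'r) ring_scheme \<Rightarrow> ('a, 'm, 'd) module_scheme \<Rightarrow> 'a set \<Rightarrow> 'm set \<Rightarrow> 'm set" where
  "localization_contraction R M P N =
     {x \<in> carrier M. \<exists>s \<in> carrier R - P. s \<odot>\<^bsub>M\<^esub> x \<in> N}"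

text \<open>The preimages in \<open>M\<close> of the colons \<open>(N\<^sub>P : P\<^sup>k)\<close>.\<close>

definition local_colon_chain ::
    "('a, 'r) ring_scheme \<Rightarrow> ('a, 'm, 'd) module_scheme \<Rightarrow> 'a set \<Rightarrow> 'm set \<Rightarrow> nat \<Rightarrow> 'm set" where
  "local_colon_chain R M P N k =
     ((\<lambda>L. colon_in_module M L P) ^^ k) (localization_contraction R M P N)"

lemma local_colon_chain_0 [simp]:
  "local_colon_chain R M P N 0 = localization_contraction R M P N"
  by (simp add: local_colon_chain_def)

lemma local_colon_chain_Suc [simp]:
  "local_colon_chain R M P N (Suc k) = colon_in_module M (local_colon_chain R M P N k) P"
  by (simp add: local_colon_chain_def)

lemma local_colon_chain_shift:
  assumes "localization_contraction R M P K = colon_in_module M (localization_contraction R M P N) P"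
  shows "local_colon_chain R M P K k = local_colon_chain R M P N (Suc k)"
  using assms by (induction k) auto

lemma local_colon_chain_stable:
  assumes "local_colon_chain R M P N (Suc k) = local_colon_chain R M P N k" and "k \<le> l"
  shows "local_colon_chain R M P N (Suc l) = local_colon_chain R M P N l"
  using assms(2,1) by (induction l rule: dec_induct) auto

lemma primeideal_subset_carrier: "primeideal P R \<Longrightarrow> P \<subseteq> carrier R"
  using primeideal.axioms(1) ideal.axioms(1) additive_subgroup.a_subset by blast

lemma primeideal_complement_mult:
  assumes "primeideal P R" "s \<in> carrier R - P" "t \<in> carrier R - P"
  shows "s \<otimes>\<^bsub>R\<^esub> t \<in> carrier R - P"
proof -
  interpret primeideal P R by fact
  show ?thesis using I_prime[of s t] assms(2,3) by auto
qed

lemma primeideal_one_notin: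
  assumes "primeideal P R"
  shows "\<one>\<^bsub>R\<^esub> \<in> carrier R - P"
proof -
  interpret primeideal P R by fact
  show ?thesis using I_notcarr one_imp_carrier by auto
qed

context module
begin

text \<open>
  The product of the finitely many denominators serves for all of them. This is what makes
  localization commute with colons by finitely generated ideals or submodules.
\<close>

lemma common_denominator:
  assumes N: "submodule N R M" and P: "primeideal P R" and A: "finite A" "f ` A \<subseteq> carrier M"
    and denominator: "\<And>a. a \<in> A \<Longrightarrow> \<exists>s \<in> carrier R - P. s \<odot>\<^bsub>M\<^esub> f a \<in> N"
  shows "\<exists>s \<in> carrier R - P. \<forall>a \<in> A. s \<odot>\<^bsub>M\<^esub> f a \<in> N"
  using A denominator
proof (induction A rule: finite_induct)
  case empty
  show ?case using primeideal_one_notin[OF P] by blast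
next
  case (insert a A)
  then obtain s where s: "s \<in> carrier R - P" "\<forall>b \<in> A. s \<odot>\<^bsub>M\<^esub> f b \<in> N"
    by auto
  obtain t where t: "t \<in> carrier R - P" "t \<odot>\<^bsub>M\<^esub> f a \<in> N"
    using insert.prems by blast
  have "(s \<otimes> t) \<odot>\<^bsub>M\<^esub> f b \<in> N" if "b \<in> insert a A" for b
  proof (cases "b = a")
    case True
    thus ?thesis
      using insert.prems s t N by (simp add: smult_assoc1 submodule_smult)
  next
    case False
    hence "(t \<otimes> s) \<odot>\<^bsub>M\<^esub> f b \<in> N"
      using that insert.prems s t N by (auto simp: smult_assoc1 submodule_smult)
    thus ?thesis using s t by (simp add: m_comm)
  qed
  thus ?case
    using primeideal_complement_mult[OF P s(1) t(1)] by blast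
qed

lemma submodule_multiplier:
  assumes N: "submodule N R M" and s: "s \<in> carrier R"
  shows "submodule {x \<in> carrier M. s \<odot>\<^bsub>M\<^esub> x \<in> N} R M"
proof -
  have "{x \<in> carrier M. s \<odot>\<^bsub>M\<^esub> x \<in> N} = colon_in_module M N {s}"
    by (auto simp: colon_in_module_def)
  thus ?thesis using submodule_colon_in_module[OF N, of "{s}"] s by simp
qed

lemma localization_contraction_expand:
  assumes N: "submodule N R M" and P: "primeideal P R"
    and s: "s \<in> carrier R - P" and x: "x \<in> carrier M"
    and "s \<odot>\<^bsub>M\<^esub> x \<in> localization_contraction R M P N"
  shows "x \<in> localization_contraction R M P N"
proof -
  obtain t where t: "t \<in> carrier R - P" "t \<odot>\<^bsub>M\<^esub> (s \<odot>\<^bsub>M\<^esub> x) \<in> N"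
    using assms by (auto simp: localization_contraction_def)
  have "(t \<otimes> s) \<odot>\<^bsub>M\<^esub> x \<in> N"
    using s t x by (simp add: smult_assoc1)
  thus ?thesis
    using primeideal_complement_mult[OF P t(1) s] x by (auto simp: localization_contraction_def)
qed

lemma subset_localization_contraction:
  assumes "submodule N R M" and "primeideal P R"
  shows "N \<subseteq> localization_contraction R M P N"
  using assms primeideal_one_notin[of P R]
  by (auto simp: localization_contraction_def submodule_subset intro!: bexI[of _ \<one>])

lemma submodule_localization_contraction:
  assumes N: "submodule N R M" and P: "primeideal P R"
  shows "submodule (localization_contraction R M P N) R M"
proof (rule submoduleI)
  fix x y
  assume x: "x \<in> localization_contraction R M P N" and y: "y \<in> localization_contraction R M P N"
  then have xy: "x \<in> carrier M" "y \<in> carrier M"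
    by (auto simp: localization_contraction_def)
  obtain s where s: "s \<in> carrier R - P" "\<forall>z \<in> {x, y}. s \<odot>\<^bsub>M\<^esub> z \<in> N"
    using common_denominator[OF N P, of "{x, y}" "\<lambda>z. z"] x y
    by (auto simp: localization_contraction_def)
  thus "x \<oplus>\<^bsub>M\<^esub> y \<in> localization_contraction R M P N"
    using xy N by (auto simp: localization_contraction_def smult_r_distr submodule_add
        intro!: bexI[of _ s])
next
  fix a x assume a: "a \<in> carrier R" and "x \<in> localization_contraction R M P N"
  then obtain s where "s \<in> carrier R - P" "s \<odot>\<^bsub>M\<^esub> x \<in> N" "x \<in> carrier M"
    by (auto simp: localization_contraction_def)
  thus "a \<odot>\<^bsub>M\<^esub> x \<in> localization_contraction R M P N"
    using a N smult_left_commute[of s a x]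
    by (auto simp: localization_contraction_def submodule_smult intro!: bexI[of _ s])
next
  show "\<zero>\<^bsub>M\<^esub> \<in> localization_contraction R M P N"
    using submodule_zero[OF N] subset_localization_contraction[OF N P] by blast
next
  fix x assume "x \<in> localization_contraction R M P N"
  then obtain s where "s \<in> carrier R - P" "s \<odot>\<^bsub>M\<^esub> x \<in> N" "x \<in> carrier M"
    by (auto simp: localization_contraction_def)
  thus "\<ominus>\<^bsub>M\<^esub> x \<in> localization_contraction R M P N"
    using N by (auto simp: localization_contraction_def smult_r_minus submodule_neg
        intro!: bexI[of _ s])
qed (auto simp: localization_contraction_def)

end

context module_over_noetherian_ring
begin

text \<open>
  A denominator common to generators of \<open>I\<close> is good for all of \<open>I\<close>, since the \<open>a\<close> for which it is
  good form an ideal.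
\<close>

lemma common_denominator_ideal:
  assumes N: "submodule N R M" and P: "primeideal P R" and I: "ideal I R" and x: "x \<in> carrier M"
    and denominator: "\<And>a. a \<in> I \<Longrightarrow> a \<odot>\<^bsub>M\<^esub> x \<in> localization_contraction R M P N"
  obtains s where "s \<in> carrier R - P" "s \<odot>\<^bsub>M\<^esub> x \<in> colon_in_module M N I"
proof -
  obtain A where A: "A \<subseteq> carrier R" "finite A" "I = Idl A"
    using finetely_gen[OF I] by blast
  have "A \<subseteq> I"
    using A genideal_self by blast
  have "\<exists>s \<in> carrier R - P. s \<odot>\<^bsub>M\<^esub> (a \<odot>\<^bsub>M\<^esub> x) \<in> N" if "a \<in> A" for a
    using denominator[of a] \<open>A \<subseteq> I\<close> that by (auto simp: localization_contraction_def)
  then obtain s where s: "s \<in> carrier R - P" "\<forall>a \<in> A. s \<odot>\<^bsub>M\<^esub> (a \<odot>\<^bsub>M\<^esub> x) \<in> N"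
    using common_denominator[OF N P A(2), of "\<lambda>a. a \<odot>\<^bsub>M\<^esub> x"] A(1) x by blast
  have "a \<odot>\<^bsub>M\<^esub> (s \<odot>\<^bsub>M\<^esub> x) \<in> N" if "a \<in> A" for a
    using that s A(1) x smult_left_commute[of s a x] by (metis DiffD1 subsetD)
  hence "A \<subseteq> {a \<in> carrier R. a \<odot>\<^bsub>M\<^esub> (s \<odot>\<^bsub>M\<^esub> x) \<in> N}"
    using A(1) by auto
  hence "I \<subseteq> {a \<in> carrier R. a \<odot>\<^bsub>M\<^esub> (s \<odot>\<^bsub>M\<^esub> x) \<in> N}"
    unfolding A(3) using s x by (intro genideal_minimal ideal_colon_element N) auto
  thus ?thesis
    using s x by (intro that[of s]) (auto simp: colon_in_module_def)
qed

lemma localization_contraction_colon: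
  assumes N: "submodule N R M" and P: "primeideal P R" and I: "ideal I R"
  shows "localization_contraction R M P (colon_in_module M N I) =
           colon_in_module M (localization_contraction R M P N) I"
proof (intro equalityI subsetI)
  fix x assume "x \<in> localization_contraction R M P (colon_in_module M N I)"
  then obtain s where s: "x \<in> carrier M" "s \<in> carrier R - P" "s \<odot>\<^bsub>M\<^esub> x \<in> colon_in_module M N I"
    by (auto simp: localization_contraction_def)
  have "s \<odot>\<^bsub>M\<^esub> (a \<odot>\<^bsub>M\<^esub> x) \<in> N" if "a \<in> I" for a
    using s that ideal.Icarr[OF I that] smult_left_commute[of s a x]
    by (auto simp: colon_in_module_def)
  thus "x \<in> colon_in_module M (localization_contraction R M P N) I"
    using s ideal.Icarr[OF I] by (auto simp: localization_contraction_def colon_in_module_def)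
next
  fix x assume "x \<in> colon_in_module M (localization_contraction R M P N) I"
  hence x: "x \<in> carrier M" "\<And>a. a \<in> I \<Longrightarrow> a \<odot>\<^bsub>M\<^esub> x \<in> localization_contraction R M P N"
    by (auto simp: colon_in_module_def)
  obtain s where "s \<in> carrier R - P" "s \<odot>\<^bsub>M\<^esub> x \<in> colon_in_module M N I"
    using common_denominator_ideal[OF N P I x] by blast
  thus "x \<in> localization_contraction R M P (colon_in_module M N I)"
    using x by (auto simp: localization_contraction_def)
qed

text \<open>
  An element \<open>x\<close> of the colon outside the localized submodule would, after multiplication by a
  denominator, be annihilated modulo \<open>N\<close> by exactly the elements of \<open>P\<close>: by all of them by
  construction, and by no others since those would be denominators themselves.
\<close>

lemma local_colon_stable_at_0:
  assumes N: "submodule N R M" and P: "primeideal P R"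
    and "P \<notin> associated_primes R (quotient_module M N)"
  shows "colon_in_module M (localization_contraction R M P N) P = localization_contraction R M P N"
proof (rule ccontr)
  let ?L = "localization_contraction R M P N"
  assume "colon_in_module M ?L P \<noteq> ?L"
  moreover have "?L \<subseteq> colon_in_module M ?L P"
    by (intro subset_colon_in_module submodule_localization_contraction N P
        primeideal_subset_carrier)
  ultimately obtain x where "x \<in> colon_in_module M ?L P" "x \<notin> ?L"
    by blast
  hence x: "x \<in> carrier M" "\<And>a. a \<in> P \<Longrightarrow> a \<odot>\<^bsub>M\<^esub> x \<in> ?L" "x \<notin> ?L"
    by (auto simp: colon_in_module_def)
  obtain s where s: "s \<in> carrier R - P" "s \<odot>\<^bsub>M\<^esub> x \<in> colon_in_module M N P"
    using common_denominator_ideal[OF N P primeideal.axioms(1)[OF P] x(1,2)] by blast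
  have "a \<in> P" if a: "a \<in> carrier R" "a \<odot>\<^bsub>M\<^esub> (s \<odot>\<^bsub>M\<^esub> x) \<in> N" for a
  proof (rule ccontr)
    assume "a \<notin> P"
    hence "s \<odot>\<^bsub>M\<^esub> x \<in> ?L"
      using a s x by (auto simp: localization_contraction_def)
    thus False
      using localization_contraction_expand[OF N P s(1) x(1)] x(3) by blast
  qed
  hence "P = {a \<in> carrier R. a \<odot>\<^bsub>M\<^esub> (s \<odot>\<^bsub>M\<^esub> x) \<in> N}"
    using s primeideal_subset_carrier[OF P] by (auto simp: colon_in_module_def)
  thus False
    using assms s x P by (auto simp: associated_primes_quotient_iff)
qed

section \<open>The effect of one regular prime extension\<close>

lemma regular_prime_extension_same:
  assumes N: "submodule N R M" and P: "regular_prime_extension R M P N K"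
  shows "localization_contraction R M P K = colon_in_module M (localization_contraction R M P N) P"
    and "colon_in_module M (localization_contraction R M P N) P \<noteq> localization_contraction R M P N"
proof -
  have ass: "P \<in> associated_primes R (quotient_module M N)" and K: "K = colon_in_module M N P"
    using P by (auto simp: regular_prime_extension_def)
  then obtain x where prime: "primeideal P R"
    and x: "x \<in> carrier M" "P = {a \<in> carrier R. a \<odot>\<^bsub>M\<^esub> x \<in> N}"
    using N by (auto simp: associated_primes_quotient_iff)
  show "localization_contraction R M P K = colon_in_module M (localization_contraction R M P N) P"
    unfolding K by (intro localization_contraction_colon N prime primeideal.axioms(1))
  have "x \<notin> localization_contraction R M P N"
    using x by (auto simp: localization_contraction_def)
  moreover have "x \<in> colon_in_module M (localization_contraction R M P N) P"
    using x subset_localization_contraction[OF N prime] by (auto simp: colon_in_module_def)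
  ultimately show
    "colon_in_module M (localization_contraction R M P N) P \<noteq> localization_contraction R M P N"
    by blast
qed

text \<open>An element of \<open>Q\<close> outside \<open>P\<close> kills \<open>K / N\<close> and becomes invertible at \<open>P\<close>.\<close>

lemma regular_prime_extension_not_below:
  assumes N: "submodule N R M" and Q: "regular_prime_extension R M Q N K"
    and P: "primeideal P R" and "\<not> Q \<subseteq> P"
  shows "localization_contraction R M P K = localization_contraction R M P N"
proof -
  have K: "K = colon_in_module M N Q" and prime: "primeideal Q R"
    using Q by (auto simp: regular_prime_extension_def associated_primes_def)
  from \<open>\<not> Q \<subseteq> P\<close> obtain a where a: "a \<in> Q" "a \<in> carrier R - P"
    using primeideal_subset_carrier[OF prime] by auto
  have "N \<subseteq> K"
    unfolding K by (intro subset_colon_in_module N primeideal_subset_carrier prime)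
  moreover have "x \<in> localization_contraction R M P N"
    if "x \<in> localization_contraction R M P K" for x
  proof -
    from that obtain s where s: "x \<in> carrier M" "s \<in> carrier R - P" "s \<odot>\<^bsub>M\<^esub> x \<in> K"
      by (auto simp: localization_contraction_def)
    have "(a \<otimes> s) \<odot>\<^bsub>M\<^esub> x \<in> N"
      using s a by (simp add: K colon_in_module_def smult_assoc1)
    thus ?thesis
      using primeideal_complement_mult[OF P a(2) s(2)] s(1)
      by (auto simp: localization_contraction_def)
  qed
  ultimately show ?thesis
    by (auto simp: localization_contraction_def)
qed

text \<open>
  Maximality of \<open>Q\<close> enters here: it keeps \<open>P\<close> from being associated to \<open>M / N\<close>. That this passes
  on to \<open>K\<close> is seen by taking the colon by \<open>Q\<close> on both sides of the first equation.
\<close>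

lemma regular_prime_extension_strictly_below:
  assumes N: "submodule N R M" and Q: "regular_prime_extension R M Q N K"
    and P: "primeideal P R" and "Q \<subset> P"
  shows "colon_in_module M (localization_contraction R M P N) P = localization_contraction R M P N"
    and "colon_in_module M (localization_contraction R M P K) P = localization_contraction R M P K"
proof -
  have K: "K = colon_in_module M N Q" and prime: "primeideal Q R"
    using Q by (auto simp: regular_prime_extension_def associated_primes_def)
  have "P \<notin> associated_primes R (quotient_module M N)"
    using Q \<open>Q \<subset> P\<close> by (auto simp: regular_prime_extension_def)
  thus stable: "colon_in_module M (localization_contraction R M P N) P =
                  localization_contraction R M P N"
    using local_colon_stable_at_0[OF N P] by blast
  have "localization_contraction R M P K = colon_in_module M (localization_contraction R M P N) Q"
    unfolding K by (intro localization_contraction_colon N P primeideal.axioms(1) prime)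
  moreover have "colon_in_module M (colon_in_module M (localization_contraction R M P N) Q) P =
      colon_in_module M (colon_in_module M (localization_contraction R M P N) P) Q"
    by (intro colon_in_module_commute primeideal_subset_carrier prime P)
  ultimately show
    "colon_in_module M (localization_contraction R M P K) P = localization_contraction R M P K"
    using stable by simp
qed

end

section \<open>The multiplicity of a prime in a filtration\<close>

lemma RPE_filtration_Nil: "RPE_filtration R M N Ms [] \<longleftrightarrow> Ms = [N] \<and> N = carrier M"
  by (cases Ms) (auto simp: RPE_filtration_def)

lemma RPE_filtration_Cons:
  "RPE_filtration R M N Ms (P # Ps) \<longleftrightarrow>
     (\<exists>K Ms'. Ms = N # Ms' \<and> regular_prime_extension R M P N K \<and> RPE_filtration R M K Ms' Ps)"
proof (cases Ms)
  case Nil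
  thus ?thesis by (simp add: RPE_filtration_def)
next
  case (Cons N' Ms')
  thus ?thesis
    by (cases Ms') (auto simp: RPE_filtration_def All_less_Suc2)
qed

lemma regular_prime_extension_primeideal:
  "regular_prime_extension R M P N K \<Longrightarrow> primeideal P R"
  by (simp add: regular_prime_extension_def associated_primes_def)

lemma regular_prime_extension_submodule:
  "regular_prime_extension R M P N K \<Longrightarrow> submodule K R M"
  unfolding regular_prime_extension_def prime_extension_def by blast

lemma RPE_filtration_primeideal:
  assumes "RPE_filtration R M N Ms Ps" "P \<in> set Ps"
  shows "primeideal P R"
  using assms regular_prime_extension_primeideal
  by (fastforce simp: RPE_filtration_def in_set_conv_nth)

context module_over_noetherian_ring
begin

text \<open>
  The right-hand side does not mention the filtration. Since the chain stays constant once it is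
  stationary, the equivalence for all \<open>k\<close> says that the multiplicity is the first stationary
  index.
\<close>

lemma count_RPE_filtration_le_iff:
  assumes "RPE_filtration R M N Ms Ps" and "submodule N R M" and P: "primeideal P R"
  shows "count (mset Ps) P \<le> k \<longleftrightarrow>
           local_colon_chain R M P N (Suc k) = local_colon_chain R M P N k"
  using assms(1,2)
proof (induction Ps arbitrary: N Ms k)
  case Nil
  have "localization_contraction R M P N = carrier M"
    using Nil subset_localization_contraction[OF Nil.prems(2) P]
    by (auto simp: RPE_filtration_Nil localization_contraction_def)
  hence "local_colon_chain R M P N 1 = local_colon_chain R M P N 0"
    using primeideal_subset_carrier[OF P] by (auto simp: colon_in_module_def)
  thus ?case
    using local_colon_chain_stable[of R M P N 0 k] by simp
next
  case (Cons Q Ps)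
  then obtain K Ms' where Q: "regular_prime_extension R M Q N K"
    and tail: "RPE_filtration R M K Ms' Ps"
    by (auto simp: RPE_filtration_Cons)
  note IH = Cons.IH[OF tail regular_prime_extension_submodule[OF Q]]
  note N = \<open>submodule N R M\<close>
  consider "Q = P" | "\<not> Q \<subseteq> P" | "Q \<subset> P"
    by blast
  thus ?case
  proof cases
    case 1
    note step = regular_prime_extension_same[OF N Q[unfolded 1]]
    show ?thesis
    proof (cases k)
      case 0
      thus ?thesis using step(2) 1 by simp
    next
      case (Suc l)
      thus ?thesis
        using IH[of l] 1 local_colon_chain_shift[OF step(1)] by simp
    qed
  next
    case 2
    hence "local_colon_chain R M P K = local_colon_chain R M P N"
      using regular_prime_extension_not_below[OF N Q P]
      by (simp add: local_colon_chain_def fun_eq_iff)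
    thus ?thesis
      using IH[of k] 2 by auto
  next
    case 3
    note step = regular_prime_extension_strictly_below[OF N Q P 3]
    have "count (mset (Q # Ps)) P \<le> 0"
      using IH[of 0] step(2) 3 by auto
    thus ?thesis
      using local_colon_chain_stable[of R M P N 0 k] step(1) by simp
  qed
qed

lemma RPE_filtration_mset_unique:
  assumes N: "submodule N R M"
    and Ps: "RPE_filtration R M N Ms Ps" and Ps': "RPE_filtration R M N Ms' Ps'"
  shows "mset Ps = mset Ps'"
proof (rule multiset_eqI)
  fix P
  show "count (mset Ps) P = count (mset Ps') P"
  proof (cases "primeideal P R")
    case True
    have "count (mset Ps) P \<le> k \<longleftrightarrow> count (mset Ps') P \<le> k" for k
      using count_RPE_filtration_le_iff[OF Ps N True] count_RPE_filtration_le_iff[OF Ps' N True]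
      by simp
    thus ?thesis by (meson le_antisym order_refl)
  next
    case False
    hence "P \<notin> set Ps" "P \<notin> set Ps'"
      using RPE_filtration_primeideal Ps Ps' by blast+
    thus ?thesis
      by (metis count_eq_zero_iff set_mset_mset)
  qed
qed

lemma prime_ideal_factorization_eqI:
  assumes "submodule N R M" and "RPE_filtration R M N Ms Ps"
  shows "prime_ideal_factorization R M N = mset Ps"
  unfolding prime_ideal_factorization_def
  using assms RPE_filtration_mset_unique by (intro the_equality) blast+

section \<open>Existence of filtrations\<close>

lemma ideal_chain_stabilizes:
  fixes I :: "nat \<Rightarrow> 'a set"
  assumes "mono I" and "\<And>n. ideal (I n) R"
  shows "\<exists>n. \<forall>m \<ge> n. I m = I n"
proof -
  have "subset.chain {I. ideal I R} (range I)"
    unfolding Zorn.subset_chain_def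
  proof (intro conjI ballI)
    fix J K assume "J \<in> range I" "K \<in> range I"
    then obtain m n where "J = I m" "K = I n"
      by blast
    thus "J \<subseteq> K \<or> K \<subseteq> J"
      using nat_le_linear[of m n] monoD[OF assms(1)] by blast
  qed (use assms(2) in blast)
  hence "\<Union> (range I) \<in> range I"
    by (intro ideal_chain_is_trivial) auto
  then obtain n where n: "\<Union> (range I) = I n"
    by blast
  have "I m = I n" if "m \<ge> n" for m
    using n monoD[OF assms(1) that] by blast
  thus ?thesis by blast
qed

text \<open>
  Among the ideals \<open>(N : x)\<close> with \<open>x \<notin> N\<close> there is a maximal one, \<open>P\<close>. It is prime, because
  \<open>(N : b x)\<close> contains \<open>(N : x)\<close> and hence equals it unless \<open>b\<close> lies in it. Every associated prime is
  among these ideals, so \<open>P\<close> is maximal there as well; and every element of \<open>(N : P)\<close> outside \<open>N\<close> has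
  colon exactly \<open>P\<close>, which is the primality of \<open>N\<close> in \<open>(N : P)\<close>.
\<close>

lemma ex_regular_prime_extension:
  assumes N: "submodule N R M" and "N \<noteq> carrier M"
  shows "\<exists>P K. regular_prime_extension R M P N K"
proof -
  let ?ann = "\<lambda>x. {a \<in> carrier R. a \<odot>\<^bsub>M\<^esub> x \<in> N}"
  let ?F = "?ann ` (carrier M - N)"
  have "\<exists>P \<in> ?F. \<forall>I \<in> ?F. P \<subseteq> I \<longrightarrow> I = P"
  proof (rule subset_Zorn)
    fix C assume C: "subset.chain ?F C"
    show "\<exists>U \<in> ?F. \<forall>I \<in> C. I \<subseteq> U"
    proof (cases "C = {}")
      case True
      have "?F \<noteq> {}" using assms submoduleE(1) by auto
      thus ?thesis using True by auto
    next
      case False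
      have "subset.chain {I. ideal I R} C"
        using C ideal_colon_element[OF N] by (auto simp: Zorn.subset_chain_def)
      hence "\<Union>C \<in> C"
        using False ideal_chain_is_trivial by blast
      moreover have "C \<subseteq> ?F"
        using C by (simp add: Zorn.subset_chain_def)
      ultimately show ?thesis by (intro bexI[of _ "\<Union>C"]) auto
    qed
  qed
  then obtain P where "P \<in> ?F" and P_maximal: "\<forall>I \<in> ?F. P \<subseteq> I \<longrightarrow> I = P"
    by (elim bexE)
  then obtain x where x: "x \<in> carrier M" "x \<notin> N" and P_def: "P = ?ann x"
    by (elim imageE DiffE) blast
  have maximal: "?ann y = ?ann x" if "y \<in> carrier M" "y \<notin> N" "?ann x \<subseteq> ?ann y" for y
    using P_maximal[unfolded P_def, rule_format, of "?ann y"] that by simp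
  have one: "\<one> \<notin> P"
    using x by (simp add: P_def)
  have prime: "primeideal P R"
  proof (rule primeidealI)
    show "ideal P R"
      unfolding P_def by (rule ideal_colon_element[OF N x(1)])
    show "carrier R \<noteq> P"
      using one by blast
    fix a b assume ab: "a \<in> carrier R" "b \<in> carrier R" "a \<otimes> b \<in> P"
    show "a \<in> P \<or> b \<in> P"
    proof (cases "b \<odot>\<^bsub>M\<^esub> x \<in> N")
      case True
      thus ?thesis using ab by (simp add: P_def)
    next
      case False
      have "?ann x \<subseteq> ?ann (b \<odot>\<^bsub>M\<^esub> x)"
        using ab x N by (auto simp: smult_left_commute[of _ b x] submodule_smult)
      hence "?ann (b \<odot>\<^bsub>M\<^esub> x) = P"
        using maximal[of "b \<odot>\<^bsub>M\<^esub> x"] ab x False by (simp add: P_def)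
      moreover have "a \<odot>\<^bsub>M\<^esub> (b \<odot>\<^bsub>M\<^esub> x) \<in> N"
        using ab x by (simp add: P_def smult_assoc1)
      ultimately show ?thesis using ab by blast
    qed
  qed (rule R.is_cring)
  have "P \<in> associated_primes R (quotient_module M N)"
    using prime x by (auto simp: associated_primes_quotient_iff[OF N] P_def)
  moreover have "Q = P" if Q: "Q \<in> associated_primes R (quotient_module M N)" "P \<subseteq> Q" for Q
  proof -
    from Q obtain y where y: "primeideal Q R" "y \<in> carrier M" "Q = ?ann y"
      by (auto simp: associated_primes_quotient_iff[OF N])
    have "y \<notin> N"
      using primeideal_one_notin[OF y(1)] y(2,3) by auto
    thus ?thesis using maximal[of y] y Q(2) by (simp add: P_def)
  qed
  moreover have "prime_extension R M P N (colon_in_module M N P)"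
  proof -
    let ?K = "colon_in_module M N P"
    have PR: "P \<subseteq> carrier R" by (rule primeideal_subset_carrier[OF prime])
    have K: "submodule ?K R M" "N \<subseteq> ?K"
      using submodule_colon_in_module[OF N PR] subset_colon_in_module[OF N PR] by auto
    have xK: "x \<in> ?K"
      using x by (simp add: colon_in_module_def P_def)
    interpret K: module R "M\<lparr>carrier := ?K\<rparr>"
      by (rule submodule.submodule_is_module[OF K(1) module_axioms])
    have "module R (M\<lparr>carrier := N\<rparr>)"
      by (rule submodule.submodule_is_module[OF N module_axioms])
    hence N': "submodule N R (M\<lparr>carrier := ?K\<rparr>)"
      using K(2) by (intro K.module_incl_imp_submodule) auto
    have colon: "colon_in_ring R (M\<lparr>carrier := ?K\<rparr>) N ?K = P"
      using xK PR by (auto simp: colon_in_ring_def) (auto simp: colon_in_module_def P_def)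
    have "a \<in> P" if "a \<in> carrier R" "y \<in> ?K" "a \<odot>\<^bsub>M\<^esub> y \<in> N" "y \<notin> N" for a y
    proof -
      have "P \<subseteq> ?ann y"
        using that PR by (auto simp: colon_in_module_def)
      hence "?ann y = P"
        using maximal[of y] that by (simp add: P_def colon_in_module_def)
      thus ?thesis using that by blast
    qed
    thus ?thesis
      using K N' colon xK x(2) by (auto simp: prime_extension_def prime_submodule_def)
  qed
  ultimately show ?thesis
    unfolding regular_prime_extension_def by blast
qed

end

text \<open>
  The ascending chain condition on \<open>H\<close>, stated through chains of submodules of the whole module
  so that \<open>H\<close> never has to be treated as a module of its own.
\<close>

definition submodule_chains_stabilize_in ::
    "('a, 'r) ring_scheme \<Rightarrow> ('a, 'm, 'd) module_scheme \<Rightarrow> 'm set \<Rightarrow> bool" where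
  "submodule_chains_stabilize_in R M H \<longleftrightarrow>
     (\<forall>f :: nat \<Rightarrow> 'm set. mono f \<and> (\<forall>n. submodule (f n) R M) \<longrightarrow>
        (\<exists>n. \<forall>m \<ge> n. f m \<inter> H = f n \<inter> H))"

lemma (in module) submodule_sum:
  assumes H: "submodule H R M" and K: "submodule K R M"
  shows "submodule {u \<oplus>\<^bsub>M\<^esub> v | u v. u \<in> H \<and> v \<in> K} R M" (is "submodule ?S R M")
proof (rule submoduleI)
  show "?S \<subseteq> carrier M"
    using assms by (auto simp: submodule_subset)
  show "\<zero>\<^bsub>M\<^esub> \<in> ?S"
    using submodule_zero[OF H] submodule_zero[OF K] M.l_zero[OF M.zero_closed] by force
next
  fix x assume "x \<in> ?S"
  then obtain u v where u: "u \<in> H" "u \<in> carrier M" and v: "v \<in> K" "v \<in> carrier M"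
    and x: "x = u \<oplus>\<^bsub>M\<^esub> v"
    using assms submodule_subset by blast
  have "\<ominus>\<^bsub>M\<^esub> x = \<ominus>\<^bsub>M\<^esub> u \<oplus>\<^bsub>M\<^esub> \<ominus>\<^bsub>M\<^esub> v"
    using u v x by (simp add: M.minus_add)
  thus "\<ominus>\<^bsub>M\<^esub> x \<in> ?S"
    using u v submodule_neg[OF H] submodule_neg[OF K] by blast
  fix a assume a: "a \<in> carrier R"
  have "a \<odot>\<^bsub>M\<^esub> x = a \<odot>\<^bsub>M\<^esub> u \<oplus>\<^bsub>M\<^esub> a \<odot>\<^bsub>M\<^esub> v"
    using a u v x by (simp add: smult_r_distr)
  thus "a \<odot>\<^bsub>M\<^esub> x \<in> ?S"
    using a u v submodule_smult[OF H] submodule_smult[OF K] by blast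
next
  fix x y assume "x \<in> ?S" "y \<in> ?S"
  then obtain u v u' v' where u: "u \<in> H" "u' \<in> H" "u \<in> carrier M" "u' \<in> carrier M"
    and v: "v \<in> K" "v' \<in> K" "v \<in> carrier M" "v' \<in> carrier M"
    and x: "x = u \<oplus>\<^bsub>M\<^esub> v" and y: "y = u' \<oplus>\<^bsub>M\<^esub> v'"
    using assms submodule_subset by blast
  have "x \<oplus>\<^bsub>M\<^esub> y = (u \<oplus>\<^bsub>M\<^esub> u') \<oplus>\<^bsub>M\<^esub> (v \<oplus>\<^bsub>M\<^esub> v')"
    using u v by (simp add: x y M.a_ac)
  thus "x \<oplus>\<^bsub>M\<^esub> y \<in> ?S"
    using u v submodule_add[OF H] submodule_add[OF K] by blast
qed

lemma (in module) submodule_cyclic: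
  assumes x: "x \<in> carrier M"
  shows "submodule ((\<lambda>r. r \<odot>\<^bsub>M\<^esub> x) ` carrier R) R M"
proof (rule submoduleI)
  show "\<zero>\<^bsub>M\<^esub> \<in> (\<lambda>r. r \<odot>\<^bsub>M\<^esub> x) ` carrier R"
    using x by (intro image_eqI[of _ _ \<zero>]) auto
next
  fix y assume "y \<in> (\<lambda>r. r \<odot>\<^bsub>M\<^esub> x) ` carrier R"
  then obtain r where r: "r \<in> carrier R" "y = r \<odot>\<^bsub>M\<^esub> x"
    by blast
  thus "\<ominus>\<^bsub>M\<^esub> y \<in> (\<lambda>r. r \<odot>\<^bsub>M\<^esub> x) ` carrier R"
    using x by (intro image_eqI[of _ _ "\<ominus> r"]) (auto simp: smult_l_minus)
  fix a assume "a \<in> carrier R"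
  thus "a \<odot>\<^bsub>M\<^esub> y \<in> (\<lambda>r. r \<odot>\<^bsub>M\<^esub> x) ` carrier R"
    using x r by (intro image_eqI[of _ _ "a \<otimes> r"]) (auto simp: smult_assoc1)
next
  fix y z assume "y \<in> (\<lambda>r. r \<odot>\<^bsub>M\<^esub> x) ` carrier R" "z \<in> (\<lambda>r. r \<odot>\<^bsub>M\<^esub> x) ` carrier R"
  then obtain r s where "r \<in> carrier R" "y = r \<odot>\<^bsub>M\<^esub> x" "s \<in> carrier R" "z = s \<odot>\<^bsub>M\<^esub> x"
    by blast
  thus "y \<oplus>\<^bsub>M\<^esub> z \<in> (\<lambda>r. r \<odot>\<^bsub>M\<^esub> x) ` carrier R"
    using x by (intro image_eqI[of _ _ "r \<oplus> s"]) (auto simp: smult_l_distr)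
qed (use x in auto)

context module_over_noetherian_ring
begin

text \<open>
  Adjoining one generator preserves the ascending chain condition: a chain in \<open>H + R x\<close> is
  controlled by its trace on \<open>H\<close> and by the ideals of those \<open>r\<close> for which \<open>r x\<close> lies, modulo \<open>H\<close>,
  in the chain, that is, by its image in the cyclic module \<open>(H + R x) / H\<close>.
\<close>

lemma submodule_chains_stabilize_adjoin:
  assumes H: "submodule H R M" and stabilize: "submodule_chains_stabilize_in R M H"
    and x: "x \<in> carrier M"
  shows "submodule_chains_stabilize_in R M
           {u \<oplus>\<^bsub>M\<^esub> v | u v. u \<in> H \<and> v \<in> (\<lambda>r. r \<odot>\<^bsub>M\<^esub> x) ` carrier R}"
    (is "submodule_chains_stabilize_in R M ?S")
  unfolding submodule_chains_stabilize_in_def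
proof (intro allI impI, elim conjE)
  fix f :: "nat \<Rightarrow> 'c set" assume "mono f" and f: "\<forall>n. submodule (f n) R M"
  define I where "I n = {r \<in> carrier R. r \<odot>\<^bsub>M\<^esub> x \<in> {u \<oplus>\<^bsub>M\<^esub> v | u v. u \<in> H \<and> v \<in> f n}}" for n
  have "mono I"
    using monoD[OF \<open>mono f\<close>] unfolding I_def by (intro monoI) blast
  moreover have "ideal (I n) R" for n
    unfolding I_def using H f x by (intro ideal_colon_element submodule_sum) auto
  ultimately obtain k where k: "\<And>m. m \<ge> k \<Longrightarrow> I m = I k"
    using ideal_chain_stabilizes by blast
  obtain l where l: "\<And>m. m \<ge> l \<Longrightarrow> f m \<inter> H = f l \<inter> H"
    using stabilize \<open>mono f\<close> f unfolding submodule_chains_stabilize_in_def by blast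
  define n where "n = max k l"
  have "y \<in> f n" if "m \<ge> n" "y \<in> f m" "y \<in> ?S" for m y
  proof -
    have fm: "submodule (f m) R M" and fn: "submodule (f n) R M" using f by auto
    obtain u r where u: "u \<in> H" "u \<in> carrier M" and r: "r \<in> carrier R"
      and y: "y = u \<oplus>\<^bsub>M\<^esub> r \<odot>\<^bsub>M\<^esub> x"
      using \<open>y \<in> ?S\<close> submodule_subset[OF H] by blast
    \<comment> \<open>Stability of the ideals replaces \<open>y\<close> by some \<open>v \<in> f n\<close> with the same class modulo \<open>H\<close>;
       stability on \<open>H\<close> then takes care of the difference.\<close>
    have "r \<odot>\<^bsub>M\<^esub> x = \<ominus>\<^bsub>M\<^esub> u \<oplus>\<^bsub>M\<^esub> y"
      using u r x y by (simp add: M.r_neg1)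
    hence "r \<in> I m"
      using r \<open>y \<in> f m\<close> submodule_neg[OF H u(1)] unfolding I_def by blast
    also have "I m = I n"
      using k[of m] k[of n] that(1) by (simp add: n_def)
    finally obtain u' v where u': "u' \<in> H" "u' \<in> carrier M" and v: "v \<in> f n" "v \<in> carrier M"
      and rx: "r \<odot>\<^bsub>M\<^esub> x = u' \<oplus>\<^bsub>M\<^esub> v"
      unfolding I_def using submodule_subset[OF H] submodule_subset[OF fn] by blast
    have sum: "y = (u \<oplus>\<^bsub>M\<^esub> u') \<oplus>\<^bsub>M\<^esub> v"
      using u u' v by (simp add: y rx M.a_assoc)
    hence "u \<oplus>\<^bsub>M\<^esub> u' = y \<oplus>\<^bsub>M\<^esub> \<ominus>\<^bsub>M\<^esub> v"
      using u u' v by (simp add: M.a_assoc M.r_neg)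
    moreover have "v \<in> f m"
      using v(1) monoD[OF \<open>mono f\<close> that(1)] by blast
    ultimately have "u \<oplus>\<^bsub>M\<^esub> u' \<in> f m"
      using \<open>y \<in> f m\<close> submodule_add[OF fm] submodule_neg[OF fm] by simp
    hence "u \<oplus>\<^bsub>M\<^esub> u' \<in> f m \<inter> H"
      using u u' submodule_add[OF H] by simp
    hence "u \<oplus>\<^bsub>M\<^esub> u' \<in> f n"
      using l[of m] l[of n] that(1) by (auto simp: n_def)
    thus ?thesis
      using sum v(1) submodule_add[OF fn] by simp
  qed
  hence "\<forall>m \<ge> n. f m \<inter> ?S = f n \<inter> ?S"
    using monoD[OF \<open>mono f\<close>] by blast
  thus "\<exists>n. \<forall>m \<ge> n. f m \<inter> ?S = f n \<inter> ?S"
    by blast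
qed

lemma finite_subset_of_stabilizing_submodule:
  assumes "finite A" and "A \<subseteq> carrier M"
  shows "\<exists>H. submodule H R M \<and> A \<subseteq> H \<and> submodule_chains_stabilize_in R M H"
  using assms
proof (induction A rule: finite_induct)
  case empty
  have "submodule {\<zero>\<^bsub>M\<^esub>} R M"
    by (rule submoduleI) auto
  moreover have "submodule_chains_stabilize_in R M {\<zero>\<^bsub>M\<^esub>}"
    unfolding submodule_chains_stabilize_in_def using submodule_zero by blast
  ultimately show ?case by blast
next
  case (insert x A)
  then obtain H where H: "submodule H R M" "A \<subseteq> H" "submodule_chains_stabilize_in R M H"
    by blast
  have x: "x \<in> carrier M" using insert.prems by blast
  let ?S = "{u \<oplus>\<^bsub>M\<^esub> v | u v. u \<in> H \<and> v \<in> (\<lambda>r. r \<odot>\<^bsub>M\<^esub> x) ` carrier R}"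
  have "u \<in> ?S" if "u \<in> H" for u
  proof -
    have "u = u \<oplus>\<^bsub>M\<^esub> \<zero> \<odot>\<^bsub>M\<^esub> x" using submodule_subset[OF H(1) that] x by simp
    thus ?thesis using that by blast
  qed
  moreover have "x \<in> ?S"
  proof -
    have "x = \<zero>\<^bsub>M\<^esub> \<oplus>\<^bsub>M\<^esub> \<one> \<odot>\<^bsub>M\<^esub> x" using x by simp
    thus ?thesis using submodule_zero[OF H(1)] by blast
  qed
  ultimately have "insert x A \<subseteq> ?S"
    using H(2) by blast
  thus ?case
    using submodule_sum[OF H(1) submodule_cyclic[OF x]]
      submodule_chains_stabilize_adjoin[OF H(1,3) x] by blast
qed

end

context finitely_generated_module_over_noetherian_ring
begin

lemma finite_generators:
  obtains A where "finite A" "A \<subseteq> carrier M"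
    "\<And>H. submodule H R M \<Longrightarrow> A \<subseteq> H \<Longrightarrow> H = carrier M"
proof -
  obtain A where "A \<subseteq> carrier M" "finite A" "carrier M = \<Inter> {H. submodule H R M \<and> A \<subseteq> H}"
    using finitely_generated by (auto simp: finitely_generated_module_def)
  thus ?thesis
    using that[of A] submoduleE(1) by blast
qed

lemma wf_submodule_supset: "wf {(K, N). submodule K R M \<and> submodule N R M \<and> N \<subset> K}"
  unfolding wf_iff_no_infinite_down_chain
proof
  assume "\<exists>f. \<forall>i. (f (Suc i), f i) \<in> {(K, N). submodule K R M \<and> submodule N R M \<and> N \<subset> K}"
  then obtain f where f: "\<And>i :: nat. submodule (f i) R M" "\<And>i. f i \<subset> f (Suc i)"
    by blast
  have "mono f"
    using f(2) by (auto simp: mono_iff_le_Suc)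
  obtain A where A: "finite A" "A \<subseteq> carrier M"
    "\<And>H. submodule H R M \<Longrightarrow> A \<subseteq> H \<Longrightarrow> H = carrier M"
    using finite_generators by blast
  have "submodule_chains_stabilize_in R M (carrier M)"
    using finite_subset_of_stabilizing_submodule[OF A(1,2)] A(3) by blast
  then obtain n where n: "\<forall>m \<ge> n. f m \<inter> carrier M = f n \<inter> carrier M"
    unfolding submodule_chains_stabilize_in_def using \<open>mono f\<close> f(1) by blast
  have "f (Suc n) = f n"
    using n[rule_format, of "Suc n"] submoduleE(1)[OF f(1)] by (simp add: Int_absorb2)
  thus False using f(2)[of n] by simp
qed

lemma ex_RPE_filtration:
  assumes "submodule N R M"
  shows "\<exists>Ms Ps. RPE_filtration R M N Ms Ps"
  using wf_submodule_supset assms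
proof (induction N rule: wf_induct_rule)
  case (less N)
  show ?case
  proof (cases "N = carrier M")
    case True
    thus ?thesis using RPE_filtration_Nil by blast
  next
    case False
    then obtain P K where K: "regular_prime_extension R M P N K"
      using ex_regular_prime_extension less.prems by blast
    hence "submodule K R M" "N \<subset> K"
      by (auto simp: regular_prime_extension_def prime_extension_def)
    then obtain Ms Ps where "RPE_filtration R M K Ms Ps"
      using less by blast
    thus ?thesis using K RPE_filtration_Cons by blast
  qed
qed

section \<open>The factorization of the annihilator\<close>

lemma RPE_filtration_of_factorization:
  assumes "submodule N R M"
  obtains Ms Ps where "RPE_filtration R M N Ms Ps" "prime_ideal_factorization R M N = mset Ps"
  using ex_RPE_filtration[OF assms] prime_ideal_factorization_eqI[OF assms] by blast

text \<open>
  Finite generation of \<open>M\<close> is essential here: it provides one denominator that multiplies \<open>r M\<close>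
  into \<open>N\<close>, whereas the right-hand side has one denominator for each element of \<open>M\<close>.
\<close>

lemma localization_contraction_annihilator:
  assumes N: "submodule N R M" and P: "primeideal P R"
  shows "localization_contraction R (module_of_ring R) P (colon_in_ring R M N (carrier M)) =
           colon_in_ring R M (localization_contraction R M P N) (carrier M)"
proof (intro equalityI subsetI)
  fix r assume "r \<in> localization_contraction R (module_of_ring R) P (colon_in_ring R M N (carrier M))"
  then obtain s where s: "r \<in> carrier R" "s \<in> carrier R - P" "\<forall>x \<in> carrier M. (s \<otimes> r) \<odot>\<^bsub>M\<^esub> x \<in> N"
    by (auto simp: localization_contraction_def colon_in_ring_def module_of_ring_def)
  thus "r \<in> colon_in_ring R M (localization_contraction R M P N) (carrier M)"
    by (auto simp: localization_contraction_def colon_in_ring_def smult_assoc1)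
next
  fix r assume "r \<in> colon_in_ring R M (localization_contraction R M P N) (carrier M)"
  hence r: "r \<in> carrier R" "\<And>x. x \<in> carrier M \<Longrightarrow> \<exists>s \<in> carrier R - P. s \<odot>\<^bsub>M\<^esub> (r \<odot>\<^bsub>M\<^esub> x) \<in> N"
    by (auto simp: localization_contraction_def colon_in_ring_def)
  obtain A where A: "finite A" "A \<subseteq> carrier M"
    "\<And>H. submodule H R M \<Longrightarrow> A \<subseteq> H \<Longrightarrow> H = carrier M"
    using finite_generators by blast
  obtain s where s: "s \<in> carrier R - P" "\<forall>x \<in> A. s \<odot>\<^bsub>M\<^esub> (r \<odot>\<^bsub>M\<^esub> x) \<in> N"
    using common_denominator[OF N P A(1), of "\<lambda>x. r \<odot>\<^bsub>M\<^esub> x"] r A(2) by blast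
  have "A \<subseteq> {x \<in> carrier M. (s \<otimes> r) \<odot>\<^bsub>M\<^esub> x \<in> N}"
    using s r(1) A(2) by (auto simp: smult_assoc1 subset_iff)
  hence "{x \<in> carrier M. (s \<otimes> r) \<odot>\<^bsub>M\<^esub> x \<in> N} = carrier M"
    using s r(1) by (intro A(3) submodule_multiplier N) auto
  thus "r \<in> localization_contraction R (module_of_ring R) P (colon_in_ring R M N (carrier M))"
    using s r(1) by (auto simp: localization_contraction_def colon_in_ring_def module_of_ring_def)
qed

lemma local_colon_chain_annihilator:
  assumes N: "submodule N R M" and P: "primeideal P R"
  shows "local_colon_chain R (module_of_ring R) P (colon_in_ring R M N (carrier M)) k =
           colon_in_ring R M (local_colon_chain R M P N k) (carrier M)"
proof (induction k)
  case 0
  show ?case using localization_contraction_annihilator[OF assms] by simp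
next
  case (Suc k)
  have "b \<in> carrier R" if "b \<in> P" for b
    using that primeideal_subset_carrier[OF P] by blast
  thus ?case
    unfolding local_colon_chain_Suc Suc.IH
    by (auto simp: smult_assoc1 colon_in_module_def colon_in_ring_def module_of_ring_def)
qed

end

lemma module_module_of_ring:
  assumes "cring R"
  shows "module R (module_of_ring R)"
proof -
  interpret cring R by fact
  have "\<exists>y \<in> carrier R. y \<oplus>\<^bsub>R\<^esub> x = \<zero>\<^bsub>R\<^esub>" if "x \<in> carrier R" for x
    using that l_neg by blast
  thus ?thesis
    by (intro moduleI[OF assms abelian_groupI])
       (auto simp: module_of_ring_def a_ac m_assoc l_distr r_distr)
qed

lemma finitely_generated_module_of_ring:
  assumes "cring R"
  shows "finitely_generated_module R (module_of_ring R)"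
proof -
  interpret cring R by fact
  interpret module R "module_of_ring R" by (rule module_module_of_ring[OF assms])
  have "r \<in> H" if H: "submodule H R (module_of_ring R)" "\<one>\<^bsub>R\<^esub> \<in> H" and r: "r \<in> carrier R" for H r
    using submodule_smult[OF H(1) r H(2)] r by (simp add: module_of_ring_def)
  moreover have "carrier (module_of_ring R) = carrier R"
    by (simp add: module_of_ring_def)
  ultimately have "carrier (module_of_ring R) =
      \<Inter> {H. submodule H R (module_of_ring R) \<and> {\<one>\<^bsub>R\<^esub>} \<subseteq> H}"
    using carrier_is_submodule by auto
  thus ?thesis
    unfolding finitely_generated_module_def
    by (intro exI[of _ "{\<one>\<^bsub>R\<^esub>}"]) (simp add: module_of_ring_def)
qed

lemma (in module) submodule_colon_in_ring:
  assumes N: "submodule N R M"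
  shows "submodule (colon_in_ring R M N (carrier M)) R (module_of_ring R)"
proof -
  interpret RR: module R "module_of_ring R" by (rule module_module_of_ring[OF R.is_cring])
  have "a_inv (module_of_ring R) a = \<ominus> a" for a
    by (simp add: module_of_ring_def a_inv_def m_inv_def)
  thus ?thesis
    using N by (intro RR.submoduleI)
      (auto simp: module_of_ring_def colon_in_ring_def submodule_zero smult_l_minus submodule_neg
         smult_l_distr submodule_add smult_assoc1 submodule_smult)
qed

theorem theorem2p6:
  fixes R :: "('a, 'r) ring_scheme"
    and M :: "('a, 'm, 'd) module_scheme"
    and N :: "'m set"
    and \<aa> :: "'a set"
  assumes "cring R"
    and "noetherian_ring R"
    and "module R M"
    and "finitely_generated_module R M"
    and "submodule N R M"
    and "N \<noteq> carrier M"
    and "\<aa> = annihilator R (quotient_module M N)"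
  shows "prime_ideal_factorization R (module_of_ring R) \<aa>
           \<subseteq># prime_ideal_factorization R M N"
proof -
  interpret M: finitely_generated_module_over_noetherian_ring R M
    using assms(2-4)
    by (intro finitely_generated_module_over_noetherian_ring.intro
        module_over_noetherian_ring.intro
        finitely_generated_module_over_noetherian_ring_axioms.intro)
  interpret RR: finitely_generated_module_over_noetherian_ring R "module_of_ring R"
    using assms(1,2) module_module_of_ring finitely_generated_module_of_ring
    by (intro finitely_generated_module_over_noetherian_ring.intro
        module_over_noetherian_ring.intro
        finitely_generated_module_over_noetherian_ring_axioms.intro)
  note N = \<open>submodule N R M\<close>
  have \<aa>: "\<aa> = colon_in_ring R M N (carrier M)"
    using assms(7) M.annihilator_quotient_module[OF N] by simp
  have \<aa>_submodule: "submodule \<aa> R (module_of_ring R)"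
    unfolding \<aa> by (rule M.submodule_colon_in_ring[OF N])
  obtain Ms Ps where Ps: "RPE_filtration R M N Ms Ps" "prime_ideal_factorization R M N = mset Ps"
    using M.RPE_filtration_of_factorization[OF N] by blast
  obtain Is Qs where Qs: "RPE_filtration R (module_of_ring R) \<aa> Is Qs"
    "prime_ideal_factorization R (module_of_ring R) \<aa> = mset Qs"
    using RR.RPE_filtration_of_factorization[OF \<aa>_submodule] by blast
  have "count (mset Qs) P \<le> count (mset Ps) P" for P
  proof (cases "primeideal P R")
    case True
    let ?k = "count (mset Ps) P"
    have "local_colon_chain R M P N (Suc ?k) = local_colon_chain R M P N ?k"
      using M.count_RPE_filtration_le_iff[OF Ps(1) N True] by blast
    hence "local_colon_chain R (module_of_ring R) P \<aa> (Suc ?k) =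
             local_colon_chain R (module_of_ring R) P \<aa> ?k"
      unfolding \<aa> M.local_colon_chain_annihilator[OF N True] by (rule arg_cong)
    thus ?thesis
      using RR.count_RPE_filtration_le_iff[OF Qs(1) \<aa>_submodule True] by blast
  next
    case False
    hence "P \<notin> set Qs"
      using RPE_filtration_primeideal[OF Qs(1)] by blast
    thus ?thesis
      by (metis count_eq_zero_iff set_mset_mset zero_le)
  qed
  thus ?thesis
    unfolding Ps(2) Qs(2) by (rule mset_subset_eqI)
qed

end
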